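(* Let $\Sigma,\Gamma$ be finite non-empty alphabets and let $E\subseteq(\Sigma\times\Gamma)^*$ be a finite valid set of input/output examples, i.e. for all $u\in\Sigma^*$ and $v_1,v_2\in\Gamma^*$, if $u*v_1\in E$ and $u*v_2\in E$ then $v_1=v_2$. Then there exists a total f-NDMM over $\Sigma\times\Gamma$, consistent with $E$, with at most $2+\sum_{w\in E}|w|$ states.
   Context: For words $u=u_1\dots u_k\in\Sigma^k$ and $v=v_1\dots v_k\in\Gamma^k$ of equal length, $u*v=(u_1,v_1)\dots(u_k,v_k)\in(\Sigma\times\Gamma)^k$; every word over $\Sigma\times\Gamma$ is uniquely of this form. $|w|$ is the length of $w$. A finite automaton is a tuple $A=(\Lambda,Q,q_{\mathrm{init}},\delta,F)$ with alphabet $\Lambda$, finite state set $Q$, one initial state $q_{\mathrm{init}}\in Q$, transition relation $\delta\subseteq Q\times\Lambda\times Q$, and accepting states $F\subseteq Q$; $\mathcal{L}(A)$ is its accepted language. It is a DFA if for each $q\in Q$ and each letter $\lambda\in\Lambda$ there is at most one $q'$ with $(q,\lambda,q')\in\delta$ (transitions may be missing). A functional non-deterministic Mealy machine (f-NDMM) is a DFA $A$ over the alphabet $\Sigma\times\Gamma$ such that for all $u\in\Sigma^*$, $v_1,v_2\in\Gamma^*$: if $u*v_1\in\mathcal{L}(A)$ and $u*v_2\in\mathcal{L}(A)$ then $v_1=v_2$. It is total if for every $u\in\Sigma^*$ there is $v\in\Gamma^*$ with $u*v\in\mathcal{L}(A)$. It is consistent with $E$ if $E\subseteq\mathcal{L}(A)$.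 *)

theory Defs
  imports Main
begin

record ('l, 'q) automaton =
  alphabet :: "'l set"
  states :: "'q set"
  initial :: 'q
  transitions :: "('q \<times> 'l \<times> 'q) set"
  accepting :: "'q set"

definition finite_automaton :: "('l, 'q) automaton \<Rightarrow> bool" where
  "finite_automaton A \<longleftrightarrow>
     finite (alphabet A) \<and> finite (states A) \<and> initial A \<in> states A \<and>
     transitions A \<subseteq> states A \<times> alphabet A \<times> states A \<and> accepting A \<subseteq> states A"

text \<open>Transitions may be missing: at most one successor for each state and letter.\<close>

definition dfa :: "('l, 'q) automaton \<Rightarrow> bool" where
  "dfa A \<longleftrightarrow> finite_automaton A \<and>
     (\<forall>q\<in>states A. \<forall>a\<in>alphabet A. \<forall>q1 q2.
        (q, a, q1) \<in> transitions A \<longrightarrow> (q, a, q2) \<in> transitions A \<longrightarrow> q1 = q2)"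

inductive run :: "('l, 'q) automaton \<Rightarrow> 'q \<Rightarrow> 'l list \<Rightarrow> 'q \<Rightarrow> bool" for A where
  run_Nil: "q \<in> states A \<Longrightarrow> run A q [] q"
| run_Cons: "(q, a, q') \<in> transitions A \<Longrightarrow> run A q' w r \<Longrightarrow> run A q (a # w) r"

definition language :: "('l, 'q) automaton \<Rightarrow> 'l list set" where
  "language A = {w. \<exists>q\<in>accepting A. run A (initial A) w q}"

text \<open>
  The word \<open>u * v\<close> over the product alphabet is \<open>zip u v\<close>. It is only meaningful for words
  of equal length, whereas \<open>zip\<close> truncates the longer list; hence the explicit length conditions.
\<close>

definition functional_on :: "'a set \<Rightarrow> 'b set \<Rightarrow> ('a \<times> 'b) list set \<Rightarrow> bool" where
  "functional_on \<Sigma> \<Gamma> L \<longleftrightarrow>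
     (\<forall>u\<in>lists \<Sigma>. \<forall>v1\<in>lists \<Gamma>. \<forall>v2\<in>lists \<Gamma>.
        length v1 = length u \<longrightarrow> length v2 = length u \<longrightarrow>
        zip u v1 \<in> L \<longrightarrow> zip u v2 \<in> L \<longrightarrow> v1 = v2)"

definition valid_examples :: "'a set \<Rightarrow> 'b set \<Rightarrow> ('a \<times> 'b) list set \<Rightarrow> bool" where
  "valid_examples \<Sigma> \<Gamma> E \<longleftrightarrow> E \<subseteq> lists (\<Sigma> \<times> \<Gamma>) \<and> functional_on \<Sigma> \<Gamma> E"

definition f_ndmm :: "'a set \<Rightarrow> 'b set \<Rightarrow> ('a \<times> 'b, 'q) automaton \<Rightarrow> bool" where
  "f_ndmm \<Sigma> \<Gamma> A \<longleftrightarrow>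
     dfa A \<and> alphabet A = \<Sigma> \<times> \<Gamma> \<and> functional_on \<Sigma> \<Gamma> (language A)"

definition total_ndmm :: "'a set \<Rightarrow> 'b set \<Rightarrow> ('a \<times> 'b, 'q) automaton \<Rightarrow> bool" where
  "total_ndmm \<Sigma> \<Gamma> A \<longleftrightarrow>
     (\<forall>u\<in>lists \<Sigma>. \<exists>v\<in>lists \<Gamma>. length v = length u \<and> zip u v \<in> language A)"

definition consistent_with :: "('a \<times> 'b, 'q) automaton \<Rightarrow> ('a \<times> 'b) list set \<Rightarrow> bool" where
  "consistent_with A E \<longleftrightarrow> E \<subseteq> language A"

end

theory Submission
  imports Defs "HOL-Library.Sublist"
begin

text \<open>
  Take the prefix tree of \<open>E\<close> together with one additional state. Several nodes of the tree may carry
  the same input word; for each such input word choose one node, namely an example whenever there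
  is one (validity makes it unique). Only the chosen nodes accept. When reading a letter \<open>s\<close> extends
  the input word of a chosen node to one that no node carries, the machine moves with an
  arbitrary fixed output letter to the additional state, where it accepts and outputs that letter
  forever. Thus every input has exactly one accepted output: follow the node chosen for the longest
  prefix carried by the tree, then pad.
\<close>

section \<open>Runs of an automaton\<close>

lemma run_Nil_iff: "run A q [] r \<longleftrightarrow> q \<in> states A \<and> r = q"
  by (subst run.simps) auto

lemma run_Cons_iff:
  "run A q (a # w) r \<longleftrightarrow> (\<exists>p. (q, a, p) \<in> transitions A \<and> run A p w r)"
  by (subst run.simps) auto

text \<open>\<open>run\<close> consumes letters at the front, but a state of the tree machine
  records the word read so far, so its runs are studied by appending letters. The bound on
  \<open>transitions\<close> makes \<open>q\<close> and \<open>r\<close> states when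
  \<open>w\<close> is empty, as \<open>run_Nil\<close> demands.\<close>

lemma run_snoc:
  assumes "transitions A \<subseteq> states A \<times> X \<times> states A"
  shows "run A q (w @ [a]) r \<longleftrightarrow> (\<exists>p. run A q w p \<and> (p, a, r) \<in> transitions A)"
proof (induction w arbitrary: q)
  case Nil
  show ?case
    using assms by (auto simp: run_Cons_iff run_Nil_iff)
next
  case (Cons b w)
  show ?case
    unfolding append_Cons run_Cons_iff Cons.IH by blast
qed

section \<open>Injective renaming of states\<close>

definition rename_states :: "('q \<Rightarrow> 'r) \<Rightarrow> ('l, 'q) automaton \<Rightarrow> ('l, 'r) automaton" where
  "rename_states f A =
     \<lparr>alphabet = alphabet A, states = f ` states A, initial = f (initial A),
      transitions = (\<lambda>(p, a, q). (f p, a, f q)) ` transitions A, accepting = f ` accepting A\<rparr>"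

lemma dfa_rename_states:
  assumes "dfa A" and inj: "inj_on f (states A)"
  shows "dfa (rename_states f A)"
proof -
  have fa: "finite_automaton A"
    and det: "\<And>q a q1 q2. q \<in> states A \<Longrightarrow> a \<in> alphabet A \<Longrightarrow> (q, a, q1) \<in> transitions A \<Longrightarrow>
      (q, a, q2) \<in> transitions A \<Longrightarrow> q1 = q2"
    using assms(1) unfolding dfa_def by blast+
  have tr: "p \<in> states A \<and> a \<in> alphabet A \<and> q \<in> states A" if "(p, a, q) \<in> transitions A" for p a q
    using fa that unfolding finite_automaton_def by blast
  have "q1 = q2" if t1: "(q, a, q1) \<in> transitions (rename_states f A)"
    and t2: "(q, a, q2) \<in> transitions (rename_states f A)" for q a q1 q2
  proof -
    obtain p1 r1 where 1: "q = f p1" "q1 = f r1" "(p1, a, r1) \<in> transitions A"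
      using t1 by (auto simp: rename_states_def)
    obtain p2 r2 where 2: "q = f p2" "q2 = f r2" "(p2, a, r2) \<in> transitions A"
      using t2 by (auto simp: rename_states_def)
    have "p1 = p2"
      using 1 2 tr inj by (metis inj_onD)
    then show ?thesis
      using 1 2 tr det by metis
  qed
  moreover have "finite_automaton (rename_states f A)"
    using fa tr unfolding finite_automaton_def rename_states_def by auto
  ultimately show ?thesis
    unfolding dfa_def by blast
qed

lemma run_rename_states:
  assumes tr: "transitions A \<subseteq> states A \<times> X \<times> states A" and inj: "inj_on f (states A)"
    and "q \<in> states A" "r \<in> states A"
  shows "run (rename_states f A) (f q) w (f r) \<longleftrightarrow> run A q w r"
  using assms(3)
proof (induction w arbitrary: q)
  case Nil
  show ?case
    using Nil assms(4) inj by (auto simp: run_Nil_iff rename_states_def dest: inj_onD)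
next
  case (Cons b w)
  \<comment> \<open>Injectivity leaves \<open>q\<close> as the only state mapped to
    \<open>f q\<close>, so the renaming gives \<open>f q\<close> no moves of other states.\<close>
  have "(f q, b, p') \<in> transitions (rename_states f A) \<longleftrightarrow>
      (\<exists>p. p' = f p \<and> (q, b, p) \<in> transitions A)" for p'
  proof
    assume "(f q, b, p') \<in> transitions (rename_states f A)"
    then obtain q' p where *: "f q = f q'" "p' = f p" "(q', b, p) \<in> transitions A"
      by (auto simp: rename_states_def)
    moreover have "q' = q"
      using * tr inj Cons.prems by (auto dest: inj_onD)
    ultimately show "\<exists>p. p' = f p \<and> (q, b, p) \<in> transitions A"
      by blast
  qed (force simp: rename_states_def)
  moreover have "p \<in> states A" if "(q, b, p) \<in> transitions A" for p
    using that tr by blast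
  ultimately show ?case
    unfolding run_Cons_iff using Cons.IH by metis
qed

lemma language_rename_states:
  assumes "finite_automaton A" and "inj_on f (states A)"
  shows "language (rename_states f A) = language A"
proof -
  have tr: "transitions A \<subseteq> states A \<times> alphabet A \<times> states A"
    and st: "initial A \<in> states A" "accepting A \<subseteq> states A"
    using assms(1) unfolding finite_automaton_def by blast+
  have "run (rename_states f A) (f (initial A)) w (f q) \<longleftrightarrow> run A (initial A) w q"
    if "q \<in> accepting A" for q w
    using run_rename_states[OF tr assms(2)] st that by blast
  moreover have "initial (rename_states f A) = f (initial A)"
    "accepting (rename_states f A) = f ` accepting A"
    by (simp_all add: rename_states_def)
  ultimately show ?thesis
    unfolding language_def by auto
qed

text \<open>Bridges the state types: the machine below is built on optional words, while the theorem
  asks for states in \<open>nat\<close>. A finite state set embeds into \<open>nat\<close>.\<close>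

lemma ex_nat_automaton:
  fixes A :: "('l, 'q) automaton"
  assumes "dfa A"
  obtains B :: "('l, nat) automaton"
  where "dfa B" "alphabet B = alphabet A" "language B = language A"
    "card (states B) = card (states A)"
proof -
  have fa: "finite_automaton A"
    using assms by (simp add: dfa_def)
  then have "finite (states A)"
    by (simp add: finite_automaton_def)
  then obtain f :: "'q \<Rightarrow> nat" where f: "inj_on f (states A)"
    using finite_imp_inj_to_nat_seg by blast
  show ?thesis
  proof (rule that[of "rename_states f A"])
    show "dfa (rename_states f A)"
      using assms f by (rule dfa_rename_states)
    show "language (rename_states f A) = language A"
      using fa f by (rule language_rename_states)
    show "card (states (rename_states f A)) = card (states A)"
      using f by (simp add: rename_states_def card_image)
  qed (simp add: rename_states_def)
qed

section \<open>The machine of a prefix tree with chosen nodes\<close>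

lemma lists_Times_iff:
  "w \<in> lists (A \<times> B) \<longleftrightarrow> map fst w \<in> lists A \<and> map snd w \<in> lists B"
  by (induction w) auto

text \<open>\<open>node\<close> is a section of the projection \<open>map fst\<close> from the tree
  to its input words. Examples are absent here: every section yields a functional and total machine,
  and consistency is left to the choice of \<open>node\<close>.\<close>

locale sectioned_tree =
  fixes \<Sigma> :: "'a set" and \<Gamma> :: "'b set" and P :: "('a \<times> 'b) list set"
    and node :: "'a list \<Rightarrow> ('a \<times> 'b) list" and \<gamma> :: 'b
  assumes finite_alphabets: "finite \<Sigma>" "finite \<Gamma>" and pad_letter: "\<gamma> \<in> \<Gamma>"
    and finite_tree: "finite P" and tree_lists: "P \<subseteq> lists (\<Sigma> \<times> \<Gamma>)"
    and root: "[] \<in> P" and prefix_closed: "w @ [x] \<in> P \<Longrightarrow> w \<in> P"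
    and node: "u \<in> map fst ` P \<Longrightarrow> node u \<in> P" "u \<in> map fst ` P \<Longrightarrow> map fst (node u) = u"
begin

abbreviation inputs :: "'a list set" where
  "inputs \<equiv> map fst ` P"

text \<open>The output function that the machine is to compute, as a word of input/output pairs. The
  disjunct \<open>u = []\<close> ensures that \<open>butlast u\<close> is shorter in the recursive
  call.\<close>

function response :: "'a list \<Rightarrow> ('a \<times> 'b) list" where
  "response u =
     (if u \<in> inputs \<or> u = [] then node u else response (butlast u) @ [(last u, \<gamma>)])"
  by auto
termination by (relation "measure length") auto

declare response.simps [simp del]

text \<open>\<open>Some w\<close> is the tree node reached by reading \<open>w\<close>, and
  \<open>None\<close> is the padding state. A chosen node for \<open>u\<close> may get stuck on
  \<open>s\<close> when another node carrying \<open>u\<close> has a child with input letter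
  \<open>s\<close>; the accepted output for \<open>u @ [s]\<close> then runs along a different
  branch.\<close>

definition machine :: "('a \<times> 'b, ('a \<times> 'b) list option) automaton" where
  "machine =
     \<lparr>alphabet = \<Sigma> \<times> \<Gamma>,
      states = insert None (Some ` P),
      initial = Some [],
      transitions =
        {(Some w, x, Some (w @ [x])) | w x. w @ [x] \<in> P} \<union>
        {(Some (node u), (s, \<gamma>), None) | u s. u \<in> inputs \<and> s \<in> \<Sigma> \<and> u @ [s] \<notin> inputs} \<union>
        {(None, (s, \<gamma>), None) | s. s \<in> \<Sigma>},
      accepting = insert None (Some ` node ` inputs)\<rparr>"

lemma inputs_prefix_closed:
  assumes "u @ [s] \<in> inputs"
  shows "u \<in> inputs"
proof -
  obtain w where w: "w \<in> P" "map fst w = u @ [s]"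
    using assms by auto
  then obtain v x where "w = v @ [x]"
    by (cases w rule: rev_cases) auto
  with w prefix_closed show ?thesis
    by (intro image_eqI[of _ _ v]) auto
qed

lemma Nil_in_inputs: "[] \<in> inputs"
  using root by force

lemma response_of_inputs: "u \<in> inputs \<Longrightarrow> response u = node u"
  by (subst response.simps) simp

lemma response_snoc: "u @ [s] \<notin> inputs \<Longrightarrow> response (u @ [s]) = response u @ [(s, \<gamma>)]"
  by (subst response.simps) simp

lemma response_wf:
  "u \<in> lists \<Sigma> \<Longrightarrow> map fst (response u) = u \<and> response u \<in> lists (\<Sigma> \<times> \<Gamma>)"
proof (induction u rule: rev_induct)
  case Nil
  show ?case
    using node[OF Nil_in_inputs] tree_lists response_of_inputs[OF Nil_in_inputs] by auto
next
  case (snoc s u)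
  show ?case
  proof (cases "u @ [s] \<in> inputs")
    case True
    show ?thesis
      using node[OF True] tree_lists response_of_inputs[OF True] by auto
  next
    case False
    show ?thesis
      using snoc pad_letter response_snoc[OF False] by auto
  qed
qed

lemma machine_transitions:
  "transitions machine \<subseteq> states machine \<times> (\<Sigma> \<times> \<Gamma>) \<times> states machine"
  using node(1) tree_lists prefix_closed pad_letter
  by (fastforce simp: machine_def)

lemma dfa_machine: "dfa machine"
proof -
  have "finite_automaton machine"
    using machine_transitions finite_alphabets finite_tree root node(1)
    by (auto simp: finite_automaton_def machine_def)
  moreover have "q1 = q2" if "(q, x, q1) \<in> transitions machine" "(q, x, q2) \<in> transitions machine"
    for q x q1 q2
  proof -
    \<comment> \<open>The only possible conflict is between a tree edge and an exit to
      \<open>None\<close> with the same letter; such an edge would put \<open>u @ [s]\<close> among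
      the inputs.\<close>
    have *: "node u @ [(s, g)] \<notin> P" if "u \<in> inputs" "u @ [s] \<notin> inputs" for u s g
      using that node(2)[OF that(1)] by (force simp: image_iff)
    show ?thesis
      using that * by (auto simp: machine_def)
  qed
  ultimately show ?thesis
    unfolding dfa_def by blast
qed

text \<open>A run leaves the tree only at a chosen node, where the word read is the
  \<open>response\<close> to its input; each later step pads, just as \<open>response\<close> does
  outside \<open>inputs\<close>. By prefix closure of \<open>inputs\<close>, no input word re-enters
  the tree.\<close>

lemma run_machine:
  "run machine (Some []) w q \<longleftrightarrow>
     (w \<in> P \<and> q = Some w) \<or>
     (w \<in> lists (\<Sigma> \<times> \<Gamma>) \<and> map fst w \<notin> inputs \<and> w = response (map fst w) \<and> q = None)"
proof (induction w arbitrary: q rule: rev_induct)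
  case Nil
  show ?case
    using root Nil_in_inputs by (auto simp: machine_def run_Nil_iff)
next
  case (snoc x w)
  obtain s g where x: "x = (s, g)"
    by (cases x)
  let ?u = "map fst w"
  have "run machine (Some []) (w @ [x]) q \<longleftrightarrow>
      (w \<in> P \<and> (Some w, x, q) \<in> transitions machine) \<or>
      (w \<in> lists (\<Sigma> \<times> \<Gamma>) \<and> ?u \<notin> inputs \<and> w = response ?u \<and> (None, x, q) \<in> transitions machine)"
    unfolding run_snoc[OF machine_transitions] snoc.IH by blast
  also have "(None, x, q) \<in> transitions machine \<longleftrightarrow> s \<in> \<Sigma> \<and> g = \<gamma> \<and> q = None"
    by (auto simp: machine_def x)
  also have "w \<in> P \<and> (Some w, x, q) \<in> transitions machine \<longleftrightarrow>
      (w @ [x] \<in> P \<and> q = Some (w @ [x])) \<or>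
      (?u \<in> inputs \<and> w = node ?u \<and> s \<in> \<Sigma> \<and> ?u @ [s] \<notin> inputs \<and> g = \<gamma> \<and> q = None)"
  proof -
    have "(Some w, x, q) \<in> transitions machine \<longleftrightarrow>
      (w @ [x] \<in> P \<and> q = Some (w @ [x])) \<or>
      (\<exists>u. w = node u \<and> u \<in> inputs \<and> s \<in> \<Sigma> \<and> u @ [s] \<notin> inputs \<and> g = \<gamma> \<and> q = None)"
      by (auto simp: machine_def x)
    \<comment> \<open>A chosen node determines its input word, so the existential over
      \<open>u\<close> collapses to \<open>?u\<close>.\<close>
    moreover have "w = node u \<and> u \<in> inputs \<longleftrightarrow> u = ?u \<and> w = node u \<and> u \<in> inputs" for u
      using node(2) by auto
    ultimately show ?thesis
      using prefix_closed node(1) by metis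
  qed
  finally have run: "run machine (Some []) (w @ [x]) q \<longleftrightarrow>
      (w @ [x] \<in> P \<and> q = Some (w @ [x])) \<or>
      (?u \<in> inputs \<and> w = node ?u \<and> s \<in> \<Sigma> \<and> ?u @ [s] \<notin> inputs \<and> g = \<gamma> \<and> q = None) \<or>
      (w \<in> lists (\<Sigma> \<times> \<Gamma>) \<and> ?u \<notin> inputs \<and> w = response ?u \<and> s \<in> \<Sigma> \<and> g = \<gamma> \<and> q = None)"
    by blast
  \<comment> \<open>If the tree carries the extended input, only the tree edge survives. Otherwise
    the tree edge is impossible, and the exit and the loop combine into one recursion step of
    \<open>response\<close>.\<close>
  show ?case
  proof (cases "?u @ [s] \<in> inputs")
    case True
    then have "?u \<in> inputs"
      by (rule inputs_prefix_closed)
    with True show ?thesis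
      unfolding run by (simp add: x)
  next
    case False
    have "w @ [x] = response (?u @ [s]) \<longleftrightarrow> w = response ?u \<and> g = \<gamma>"
      using response_snoc[OF False] by (auto simp: x)
    moreover have "w \<in> lists (\<Sigma> \<times> \<Gamma>)" if "?u \<in> inputs" "w = node ?u"
      using that node(1) tree_lists by (metis subsetD)
    ultimately show ?thesis
      unfolding run using False response_of_inputs[of ?u] pad_letter by (auto simp: x)
  qed
qed

text \<open>Since only chosen nodes accept inside the tree, both cases of \<open>run_machine\<close>
  reduce to agreement with \<open>response\<close>. The language is thus the graph of a function,
  which gives functionality and totality.\<close>

lemma language_machine:
  "language machine = {w \<in> lists (\<Sigma> \<times> \<Gamma>). w = response (map fst w)}"
proof -
  have "w \<in> language machine \<longleftrightarrow> w \<in> lists (\<Sigma> \<times> \<Gamma>) \<and> w = response (map fst w)" for w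
  proof -
    have "w \<in> language machine \<longleftrightarrow> w \<in> node ` inputs \<and> w \<in> P \<or>
        w \<in> lists (\<Sigma> \<times> \<Gamma>) \<and> map fst w \<notin> inputs \<and> w = response (map fst w)"
    proof -
      have "initial machine = Some []" "accepting machine = insert None (Some ` node ` inputs)"
        by (simp_all add: machine_def)
      then show ?thesis
        unfolding language_def by (auto simp: run_machine)
    qed
    also have "w \<in> node ` inputs \<and> w \<in> P \<longleftrightarrow> map fst w \<in> inputs \<and> w = response (map fst w)"
    proof
      assume "w \<in> node ` inputs \<and> w \<in> P"
      then obtain u where "u \<in> inputs" "w = node u"
        by blast
      then show "map fst w \<in> inputs \<and> w = response (map fst w)"
        using node(2) response_of_inputs by metis
    next
      assume *: "map fst w \<in> inputs \<and> w = response (map fst w)"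
      then have "w = node (map fst w)"
        using response_of_inputs by metis
      then show "w \<in> node ` inputs \<and> w \<in> P"
        using * node(1) by (metis image_eqI)
    qed
    also have "\<dots> \<longleftrightarrow> map fst w \<in> inputs \<and> w = response (map fst w) \<and> w \<in> lists (\<Sigma> \<times> \<Gamma>)"
      using response_of_inputs node(1) tree_lists by (metis subsetD)
    finally show ?thesis
      by blast
  qed
  then show ?thesis
    by blast
qed

lemma functional_on_language_machine: "functional_on \<Sigma> \<Gamma> (language machine)"
  unfolding functional_on_def
proof (intro ballI impI)
  fix u v1 v2
  assume "length v1 = length u" "length v2 = length u"
    and "zip u v1 \<in> language machine" "zip u v2 \<in> language machine"
  then have "zip u v1 = response u" "zip u v2 = response u"
    by (simp_all add: language_machine)
  then show "v1 = v2"
    using \<open>length v1 = length u\<close> \<open>length v2 = length u\<close> by (metis map_snd_zip)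
qed

lemma total_language_machine:
  assumes "u \<in> lists \<Sigma>"
  shows "\<exists>v\<in>lists \<Gamma>. length v = length u \<and> zip u v \<in> language machine"
proof (intro bexI conjI)
  let ?v = "map snd (response u)"
  have *: "map fst (response u) = u" "response u \<in> lists (\<Sigma> \<times> \<Gamma>)"
    using response_wf[OF assms] by auto
  then show "length ?v = length u"
    by (metis length_map)
  have "zip u ?v = response u"
    using * by (metis zip_map_fst_snd)
  with * show "zip u ?v \<in> language machine"
    by (simp add: language_machine)
  show "?v \<in> lists \<Gamma>"
    using *(2) by (simp add: lists_Times_iff)
qed

lemma node_in_language_machine:
  assumes "u \<in> inputs"
  shows "node u \<in> language machine"
  using assms node[OF assms] response_of_inputs[OF assms] tree_lists
  by (auto simp: language_machine)

end

section \<open>Size of the prefix tree and choice of nodes\<close>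

lemma card_prefixes_le:
  fixes E :: "'a list set"
  assumes "finite E"
  shows "finite (insert [] (\<Union>w\<in>E. set (prefixes w)))"
    and "card (insert [] (\<Union>w\<in>E. set (prefixes w))) \<le> 1 + (\<Sum>w\<in>E. length w)"
proof -
  \<comment> \<open>The empty prefix is common to all words and is counted once; each
    \<open>w\<close> then contributes its \<open>length w\<close> nonempty prefixes.\<close>
  let ?N = "\<lambda>w. set (prefixes w) - {[]}"
  show "finite (insert [] (\<Union>w\<in>E. set (prefixes w)))"
    using assms by simp
  have "insert [] (\<Union>w\<in>E. set (prefixes w)) = insert [] (\<Union>w\<in>E. ?N w)"
    by blast
  moreover have "card (insert [] (\<Union>w\<in>E. ?N w)) = Suc (card (\<Union>w\<in>E. ?N w))"
    using assms by (subst card_insert_disjoint) auto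
  moreover have "card (\<Union>w\<in>E. ?N w) \<le> (\<Sum>w\<in>E. card (?N w))"
    using assms by (rule card_UN_le)
  moreover have "card (?N w) = length w" for w :: "'a list"
    using distinct_card[OF distinct_prefixes, of w] by (simp add: card_Diff_singleton)
  ultimately show "card (insert [] (\<Union>w\<in>E. set (prefixes w))) \<le> 1 + (\<Sum>w\<in>E. length w)"
    by simp
qed

text \<open>Validity makes an example recoverable from its input word, so that
  \<open>inv_into E (map fst)\<close> returns the example itself.\<close>

lemma valid_examples_inj_on:
  assumes "valid_examples \<Sigma> \<Gamma> E"
  shows "inj_on (map fst) E"
proof (rule inj_onI)
  fix w w'
  assume E: "w \<in> E" "w' \<in> E" and eq: "map fst w = map fst w'"
  let ?u = "map fst w"
  have "w \<in> lists (\<Sigma> \<times> \<Gamma>)" "w' \<in> lists (\<Sigma> \<times> \<Gamma>)"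
    using assms E by (auto simp: valid_examples_def)
  then have "?u \<in> lists \<Sigma>" "map snd w \<in> lists \<Gamma>" "map snd w' \<in> lists \<Gamma>"
    by (simp_all add: lists_Times_iff)
  moreover have "zip ?u (map snd w) = w" "zip ?u (map snd w') = w'"
    by (rule zip_map_fst_snd) (simp add: eq zip_map_fst_snd)
  moreover have "length (map snd w) = length ?u" "length (map snd w') = length ?u"
    using arg_cong[OF eq, of length] by simp_all
  ultimately have "map snd w = map snd w'"
    using assms E unfolding valid_examples_def functional_on_def by metis
  with eq show "w = w'"
    by (metis zip_map_fst_snd)
qed

theorem lemma3:
  fixes \<Sigma> :: "'a set" and \<Gamma> :: "'b set" and E :: "('a \<times> 'b) list set"
  assumes "finite \<Sigma>" and "\<Sigma> \<noteq> {}"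
    and "finite \<Gamma>" and "\<Gamma> \<noteq> {}"
    and "finite E" and "valid_examples \<Sigma> \<Gamma> E"
  shows "\<exists>A :: ('a \<times> 'b, nat) automaton.
           f_ndmm \<Sigma> \<Gamma> A \<and> total_ndmm \<Sigma> \<Gamma> A \<and> consistent_with A E \<and>
           card (states A) \<le> 2 + (\<Sum>w\<in>E. length w)"
proof -
  define P where "P = insert [] (\<Union>w\<in>E. set (prefixes w))"
  \<comment> \<open>Examples take precedence, so each becomes an accepting node; for other inputs
    any node of the tree will do.\<close>
  define node where
    "node u = (if u \<in> map fst ` E then inv_into E (map fst) u else inv_into P (map fst) u)" for u
  obtain \<gamma> where \<gamma>: "\<gamma> \<in> \<Gamma>"
    using assms(4) by blast
  have E_P: "E \<subseteq> P"
    by (auto simp: P_def)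
  have node_E: "node (map fst w) = w" if "w \<in> E" for w
    using that valid_examples_inj_on[OF assms(6)] by (simp add: node_def)
  interpret sectioned_tree \<Sigma> \<Gamma> P node \<gamma>
  proof
    show "finite P"
      unfolding P_def using assms(5) by (rule card_prefixes_le)
    show "P \<subseteq> lists (\<Sigma> \<times> \<Gamma>)"
      using assms(6) set_mono_prefix by (fastforce simp: P_def valid_examples_def in_lists_conv_set)
    show "w \<in> P" if "w @ [x] \<in> P" for w x
      using that by (auto simp: P_def dest: append_prefixD)
    show "node u \<in> P" if "u \<in> map fst ` P" for u
      using that E_P inv_into_into[of u "map fst" E] inv_into_into[of u "map fst" P]
      by (auto simp: node_def)
    show "map fst (node u) = u" if "u \<in> map fst ` P" for u
      using that by (simp add: node_def f_inv_into_f)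
  qed (use assms \<gamma> in \<open>auto simp: P_def\<close>)
  obtain A :: "('a \<times> 'b, nat) automaton" where A: "dfa A" "alphabet A = alphabet machine"
    "language A = language machine" "card (states A) = card (states machine)"
    using ex_nat_automaton[OF dfa_machine] .
  have "f_ndmm \<Sigma> \<Gamma> A"
    using A functional_on_language_machine by (simp add: f_ndmm_def machine_def)
  moreover have "total_ndmm \<Sigma> \<Gamma> A"
    using A total_language_machine by (simp add: total_ndmm_def)
  moreover have "consistent_with A E"
    using A node_in_language_machine node_E E_P by (fastforce simp: consistent_with_def)
  moreover have "card (states A) \<le> 2 + (\<Sum>w\<in>E. length w)"
  proof -
    \<comment> \<open>The successor counts \<open>None\<close>; the other unit of the bound
      \<open>2 + ...\<close> is the root.\<close>
    have "card (states machine) = Suc (card P)"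
      using finite_tree by (simp add: machine_def card_image)
    then show ?thesis
      using A(4) card_prefixes_le(2)[OF assms(5)] by (simp add: P_def)
  qed
  ultimately show ?thesis
    by blast
qed

end
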